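(* (Time reversibility 2.) Let $R \in \mathcal{P}$ be a reachable RMPC process in which the parallel composition operator does not occur. Then the underlying CTMC $\mathcal{M}[\![R]\!]$ is time reversible (for arbitrary backward rates).
   Context: RMPC. Fix a countable set $\mathcal{A}$ of actions, rates in $\mathbb{R}_{>0}$, and a countable set $\mathcal{K}$ of keys. Forward processes: $P,Q ::= \mathbf{0} \mid \langle a,\lambda\rangle.P \mid P+Q \mid P\parallel_L Q$ ($L\subseteq\mathcal A$); reversible processes: $R,S ::= P \mid \langle a,\lambda\rangle[i].R \mid R+S \mid R\parallel_L S$ ($i\in\mathcal K$). $\mathrm{std}(R)$ means $R$ is a forward process; $\mathrm{key}(R)$ is the set of keys occurring in $R$. Every rate $\lambda$ has an associated backward rate $\overline{\lambda}>0$ (arbitrary). Forward $\to$ and backward $\rightsquigarrow$ transition relations are the least relations closed under (symmetric variants of Cho, Par, Cho$^r$, Par$^r$ included): (Act1) if $\mathrm{std}(R)$ then $\langle a,\lambda\rangle.R \xrightarrow{\langle a,\lambda\rangle[i]} \langle a,\lambda\rangle[i].R$ for every $i\in\mathcal K$; (Act1$^r$) if $\mathrm{std}(R)$ then $\langle a,\lambda\rangle[i].R \rightsquigarrow^{\langle a,\overline\lambda\rangle[i]} \langle a,\lambda\rangle.R$. (Act2) if $R\xrightarrow{\langle b,\mu\rangle[j]}R'$ and $j\neq i$ then $\langle a,\lambda\rangle[i].R\xrightarrow{\langle b,\mu\rangle[j]}\langle a,\lambda\rangle[i].R'$; (Act2$^r$) the same with $\rightsquigarrow$ and label $\langle b,\overline\mu\rangle[j]$.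 (Cho) if $R\xrightarrow{\ell}R'$ and $\mathrm{std}(S)$ then $R+S\xrightarrow{\ell}R'+S$; (Cho$^r$) the same with $\rightsquigarrow$. (Par) if $R\xrightarrow{\langle a,\lambda\rangle[i]}R'$, $a\notin L$, $i\notin\mathrm{key}(S)$ then $R\parallel_L S\xrightarrow{\langle a,\lambda\rangle[i]}R'\parallel_L S$; (Par$^r$) the same with $\rightsquigarrow$. (Coo) if $R\xrightarrow{\langle a,\lambda\rangle[i]}R'$, $S\xrightarrow{\langle a,\mu\rangle[i]}S'$, $a\in L$ then $R\parallel_L S\xrightarrow{\langle a,\lambda\cdot\mu\rangle[i]}R'\parallel_L S'$; (Coo$^r$) if $R\rightsquigarrow^{\langle a,\overline\lambda\rangle[i]}R'$, $S\rightsquigarrow^{\langle a,\overline\mu\rangle[i]}S'$, $a\in L$ then $R\parallel_L S\rightsquigarrow^{\langle a,\overline\lambda\cdot\overline\mu\rangle[i]}R'\parallel_L S'$. $\mathcal P$ (reachable processes) = forward processes plus all processes obtained from them by finitely many forward transitions. Process contexts: $\mathcal C ::= \bullet \mid \langle a,\lambda\rangle[i].\mathcal C \mid R+\mathcal C \mid \mathcal C+R \mid R\parallel_L\mathcal C \mid \mathcal C\parallel_L R$. $\equiv_{\mathcal K}$ is the smallest equivalence relation on $\mathcal P$ such that: (i) if $\mathcal C$ contains no $\parallel_L$ with $a\in L$ and $i,j$ do not occur in $\mathcal C$ and $R$, then $\mathcal C[\langle a,\lambda\rangle[i].R]\equiv_{\mathcal K}\mathcal C[\langle a,\lambda\rangle[j].R]$;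 (ii) if $n\ge 2$, $a\in L_1\cap\dots\cap L_{n-1}$, $i,j$ do not occur in $\mathcal C,\mathcal C_1,\dots,\mathcal C_n,R_1,\dots,R_n$, and no further $a$ with key $i$ occurs in $\mathcal C$, then $\mathcal C[\mathcal C_1[\langle a,\lambda_1\rangle[i].R_1]\parallel_{L_1}\dots\parallel_{L_{n-1}}\mathcal C_n[\langle a,\lambda_n\rangle[i].R_n]]\equiv_{\mathcal K}$ the same term with $i$ replaced by $j$ in these $n$ prefixes. The underlying CTMC $\mathcal M[\![R]\!]$ has as states the $\equiv_{\mathcal K}$-classes reachable from the initial state $[R]_{\equiv_{\mathcal K}}$, a transition $[S]\xrightarrow{\langle a,\lambda\rangle}[S']$ whenever $S\xrightarrow{\langle a,\lambda\rangle[i]}S'$ for some $i$, and a transition $[S]\rightsquigarrow^{\langle a,\overline\lambda\rangle}[S']$ whenever $S\rightsquigarrow^{\langle a,\overline\lambda\rangle[i]}S'$ for some $i$; it is the continuous-time Markov chain whose rate $q_{s,s'}$ from $s$ to $s'\neq s$ is the sum of the rates of all transitions from $s$ to $s'$. A stationary CTMC is time reversible iff its joint distributions are invariant under time reversal; equivalently, iff its steady-state distribution $\pi$ satisfies $\pi(s)q_{s,s'}=\pi(s')q_{s',s}$ for all $s\neq s'$. *)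

theory Defs
  imports "HOL-Analysis.Infinite_Sum" "HOL-Probability.Probability_Mass_Function"
begin

section \<open>Processes\<close>

text \<open>\<open>Pre a l P\<close> is an unexecuted prefix, \<open>Exec a l i R\<close> a prefix executed with key \<open>i\<close>.
  The raw type also contains terms outside the grammar (an executed prefix below an unexecuted
  one, nonpositive rates); they are excluded by \<open>std\<close> and \<open>reachable_procs\<close>.\<close>

datatype ('a, 'k) proc =
    Stop
  | Pre 'a real "('a, 'k) proc"
  | Exec 'a real 'k "('a, 'k) proc"
  | Cho "('a, 'k) proc" "('a, 'k) proc"
  | Par "'a set" "('a, 'k) proc" "('a, 'k) proc"

primrec std :: "('a, 'k) proc \<Rightarrow> bool" where
  "std Stop = True"
| "std (Pre a l P) = (l > 0 \<and> std P)"
| "std (Exec a l i R) = False"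
| "std (Cho R S) = (std R \<and> std S)"
| "std (Par L R S) = (std R \<and> std S)"

primrec keys :: "('a, 'k) proc \<Rightarrow> 'k set" where
  "keys Stop = {}"
| "keys (Pre a l P) = keys P"
| "keys (Exec a l i R) = insert i (keys R)"
| "keys (Cho R S) = keys R \<union> keys S"
| "keys (Par L R S) = keys R \<union> keys S"

text \<open>The union of all synchronization sets occurring in a process.\<close>

primrec sync_acts :: "('a, 'k) proc \<Rightarrow> 'a set" where
  "sync_acts Stop = {}"
| "sync_acts (Pre a l P) = sync_acts P"
| "sync_acts (Exec a l i R) = sync_acts R"
| "sync_acts (Cho R S) = sync_acts R \<union> sync_acts S"
| "sync_acts (Par L R S) = L \<union> sync_acts R \<union> sync_acts S"

primrec par_free :: "('a, 'k) proc \<Rightarrow> bool" where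
  "par_free Stop = True"
| "par_free (Pre a l P) = par_free P"
| "par_free (Exec a l i R) = par_free R"
| "par_free (Cho R S) = (par_free R \<and> par_free S)"
| "par_free (Par L R S) = False"


section \<open>Transitions\<close>

text \<open>A label \<open>(a, r, i)\<close> consists of action, rate and key.\<close>

inductive fstep :: "('a, 'k) proc \<Rightarrow> 'a \<times> real \<times> 'k \<Rightarrow> ('a, 'k) proc \<Rightarrow> bool" where
  Act1: "std R \<Longrightarrow> fstep (Pre a l R) (a, l, i) (Exec a l i R)"
| Act2: "fstep R (b, m, j) R' \<Longrightarrow> j \<noteq> i \<Longrightarrow> fstep (Exec a l i R) (b, m, j) (Exec a l i R')"
| ChoL: "fstep R x R' \<Longrightarrow> std S \<Longrightarrow> fstep (Cho R S) x (Cho R' S)"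
| ChoR: "fstep S x S' \<Longrightarrow> std R \<Longrightarrow> fstep (Cho R S) x (Cho R S')"
| ParL: "fstep R (a, l, i) R' \<Longrightarrow> a \<notin> L \<Longrightarrow> i \<notin> keys S \<Longrightarrow> fstep (Par L R S) (a, l, i) (Par L R' S)"
| ParR: "fstep S (a, l, i) S' \<Longrightarrow> a \<notin> L \<Longrightarrow> i \<notin> keys R \<Longrightarrow> fstep (Par L R S) (a, l, i) (Par L R S')"
| Coo: "fstep R (a, l, i) R' \<Longrightarrow> fstep S (a, m, i) S' \<Longrightarrow> a \<in> L
    \<Longrightarrow> fstep (Par L R S) (a, l * m, i) (Par L R' S')"

text \<open>\<open>bw l\<close> is the backward rate associated with the rate \<open>l\<close>.\<close>

inductive bstep :: "(real \<Rightarrow> real) \<Rightarrow> ('a, 'k) proc \<Rightarrow> 'a \<times> real \<times> 'k \<Rightarrow> ('a, 'k) proc \<Rightarrow> bool"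
  for bw where
  Act1r: "std R \<Longrightarrow> bstep bw (Exec a l i R) (a, bw l, i) (Pre a l R)"
| Act2r: "bstep bw R (b, m, j) R' \<Longrightarrow> j \<noteq> i \<Longrightarrow> bstep bw (Exec a l i R) (b, m, j) (Exec a l i R')"
| ChoLr: "bstep bw R x R' \<Longrightarrow> std S \<Longrightarrow> bstep bw (Cho R S) x (Cho R' S)"
| ChoRr: "bstep bw S x S' \<Longrightarrow> std R \<Longrightarrow> bstep bw (Cho R S) x (Cho R S')"
| ParLr: "bstep bw R (a, l, i) R' \<Longrightarrow> a \<notin> L \<Longrightarrow> i \<notin> keys S
    \<Longrightarrow> bstep bw (Par L R S) (a, l, i) (Par L R' S)"
| ParRr: "bstep bw S (a, l, i) S' \<Longrightarrow> a \<notin> L \<Longrightarrow> i \<notin> keys R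
    \<Longrightarrow> bstep bw (Par L R S) (a, l, i) (Par L R S')"
| Coor: "bstep bw R (a, l, i) R' \<Longrightarrow> bstep bw S (a, m, i) S' \<Longrightarrow> a \<in> L
    \<Longrightarrow> bstep bw (Par L R S) (a, l * m, i) (Par L R' S')"

definition reachable_procs :: "('a, 'k) proc set" where
  "reachable_procs = {R. \<exists>P. std P \<and> (\<lambda>S S'. \<exists>x. fstep S x S')\<^sup>*\<^sup>* P R}"


section \<open>Equivalence up to keys\<close>

datatype ('a, 'k) ctx =
    Hole
  | CExec 'a real 'k "('a, 'k) ctx"
  | CChoR "('a, 'k) proc" "('a, 'k) ctx"
  | CChoL "('a, 'k) ctx" "('a, 'k) proc"
  | CParR "'a set" "('a, 'k) proc" "('a, 'k) ctx"
  | CParL "'a set" "('a, 'k) ctx" "('a, 'k) proc"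

primrec plug :: "('a, 'k) ctx \<Rightarrow> ('a, 'k) proc \<Rightarrow> ('a, 'k) proc" where
  "plug Hole T = T"
| "plug (CExec a l i C) T = Exec a l i (plug C T)"
| "plug (CChoR R C) T = Cho R (plug C T)"
| "plug (CChoL C R) T = Cho (plug C T) R"
| "plug (CParR L R C) T = Par L R (plug C T)"
| "plug (CParL L C R) T = Par L (plug C T) R"

primrec ctx_keys :: "('a, 'k) ctx \<Rightarrow> 'k set" where
  "ctx_keys Hole = {}"
| "ctx_keys (CExec a l i C) = insert i (ctx_keys C)"
| "ctx_keys (CChoR R C) = keys R \<union> ctx_keys C"
| "ctx_keys (CChoL C R) = ctx_keys C \<union> keys R"
| "ctx_keys (CParR L R C) = keys R \<union> ctx_keys C"
| "ctx_keys (CParL L C R) = ctx_keys C \<union> keys R"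

primrec ctx_sync_acts :: "('a, 'k) ctx \<Rightarrow> 'a set" where
  "ctx_sync_acts Hole = {}"
| "ctx_sync_acts (CExec a l i C) = ctx_sync_acts C"
| "ctx_sync_acts (CChoR R C) = sync_acts R \<union> ctx_sync_acts C"
| "ctx_sync_acts (CChoL C R) = ctx_sync_acts C \<union> sync_acts R"
| "ctx_sync_acts (CParR L R C) = L \<union> sync_acts R \<union> ctx_sync_acts C"
| "ctx_sync_acts (CParL L C R) = L \<union> ctx_sync_acts C \<union> sync_acts R"

text \<open>\<open>sync_rename a i j T T'\<close>: \<open>T\<close> is an arbitrarily bracketed composition of \<open>n \<ge> 1\<close> components
  \<open>C\<^sub>k[<a,l\<^sub>k>[i].R\<^sub>k]\<close> by parallel operators all of which synchronize on \<open>a\<close>, and \<open>T'\<close> arises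
  from \<open>T\<close> by replacing the key \<open>i\<close> of these \<open>n\<close> prefixes by \<open>j\<close>.\<close>

inductive sync_rename :: "'a \<Rightarrow> 'k \<Rightarrow> 'k \<Rightarrow> ('a, 'k) proc \<Rightarrow> ('a, 'k) proc \<Rightarrow> bool"
  for a i j where
  component: "i \<notin> ctx_keys C \<Longrightarrow> j \<notin> ctx_keys C \<Longrightarrow> i \<notin> keys R \<Longrightarrow> j \<notin> keys R
    \<Longrightarrow> sync_rename a i j (plug C (Exec a l i R)) (plug C (Exec a l j R))"
| compose: "sync_rename a i j T T' \<Longrightarrow> sync_rename a i j U U' \<Longrightarrow> a \<in> L
    \<Longrightarrow> sync_rename a i j (Par L T U) (Par L T' U')"

text \<open>In \<open>sync\<close> the outermost parallel operator is explicit, so that \<open>n \<ge> 2\<close>; that no further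
  \<open>a\<close> with key \<open>i\<close> occurs in \<open>C\<close> is subsumed by \<open>i \<notin> ctx_keys C\<close>.\<close>

inductive keq :: "('a, 'k) proc \<Rightarrow> ('a, 'k) proc \<Rightarrow> bool" where
  refl: "R \<in> reachable_procs \<Longrightarrow> keq R R"
| sym: "keq R S \<Longrightarrow> keq S R"
| trans: "keq R S \<Longrightarrow> keq S T \<Longrightarrow> keq R T"
| nosync: "a \<notin> ctx_sync_acts C \<Longrightarrow> i \<notin> ctx_keys C \<Longrightarrow> j \<notin> ctx_keys C \<Longrightarrow> i \<notin> keys R \<Longrightarrow> j \<notin> keys R
    \<Longrightarrow> plug C (Exec a l i R) \<in> reachable_procs \<Longrightarrow> plug C (Exec a l j R) \<in> reachable_procs
    \<Longrightarrow> keq (plug C (Exec a l i R)) (plug C (Exec a l j R))"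
| sync: "sync_rename a i j T T' \<Longrightarrow> sync_rename a i j U U' \<Longrightarrow> a \<in> L
    \<Longrightarrow> i \<notin> ctx_keys C \<Longrightarrow> j \<notin> ctx_keys C
    \<Longrightarrow> plug C (Par L T U) \<in> reachable_procs \<Longrightarrow> plug C (Par L T' U') \<in> reachable_procs
    \<Longrightarrow> keq (plug C (Par L T U)) (plug C (Par L T' U'))"

definition kclass :: "('a, 'k) proc \<Rightarrow> ('a, 'k) proc set" where
  "kclass R = {S. keq R S}"


section \<open>Finite continuous-time Markov chains\<close>

text \<open>A chain is given by its state space and the rates between distinct states.\<close>

type_synonym 's ctmc = "'s set \<times> ('s \<Rightarrow> 's \<Rightarrow> real)"

definition generator :: "'s ctmc \<Rightarrow> 's \<Rightarrow> 's \<Rightarrow> real" where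
  "generator M s s' = (if s = s' then - (\<Sum>u\<in>fst M - {s}. snd M s u) else snd M s s')"

primrec generator_power :: "'s ctmc \<Rightarrow> nat \<Rightarrow> 's \<Rightarrow> 's \<Rightarrow> real" where
  "generator_power M 0 s s' = (if s = s' then 1 else 0)"
| "generator_power M (Suc n) s s' = (\<Sum>u\<in>fst M. generator M s u * generator_power M n u s')"

text \<open>The probability of being in \<open>s'\<close> after time \<open>t\<close> when starting in \<open>s\<close>: the entry of the
  matrix exponential of \<open>t\<close> times the generator.\<close>

definition transition_prob :: "'s ctmc \<Rightarrow> real \<Rightarrow> 's \<Rightarrow> 's \<Rightarrow> real" where
  "transition_prob M t s s' = (\<Sum>n. t ^ n / fact n * generator_power M n s s')"

definition steady_state :: "'s ctmc \<Rightarrow> 's pmf \<Rightarrow> bool" where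
  "steady_state M p \<longleftrightarrow> set_pmf p \<subseteq> fst M \<and>
     (\<forall>s'\<in>fst M. (\<Sum>s\<in>fst M. pmf p s * generator M s s') = 0)"

fun path_prob :: "'s ctmc \<Rightarrow> real \<times> 's \<Rightarrow> (real \<times> 's) list \<Rightarrow> real" where
  "path_prob M x [] = 1"
| "path_prob M (t, s) ((t', s') # xs) =
     transition_prob M (t' - t) s s' * path_prob M (t', s') xs"

text \<open>For \<open>t\<^sub>1 \<le> \<dots> \<le> t\<^sub>n\<close> and the chain \<open>X\<close> started in the steady state \<open>p\<close>,
  \<open>joint_prob M p [(t\<^sub>1, s\<^sub>1), \<dots>, (t\<^sub>n, s\<^sub>n)]\<close> is the probability that
  \<open>X t\<^sub>1 = s\<^sub>1, \<dots>, X t\<^sub>n = s\<^sub>n\<close>.\<close>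

fun joint_prob :: "'s ctmc \<Rightarrow> 's pmf \<Rightarrow> (real \<times> 's) list \<Rightarrow> real" where
  "joint_prob M p [] = 1"
| "joint_prob M p ((t, s) # xs) = pmf p s * path_prob M (t, s) xs"

text \<open>Time reversibility: the steady state exists and is unique, and the stationary chain
  \<open>X t\<close> and its reversal \<open>X (T - t)\<close> have the same joint distributions. The reversal is in
  \<open>s\<^sub>1, \<dots>, s\<^sub>n\<close> at times \<open>t\<^sub>1 \<le> \<dots> \<le> t\<^sub>n\<close> iff \<open>X\<close> is in \<open>s\<^sub>n, \<dots>, s\<^sub>1\<close> at times
  \<open>T - t\<^sub>n \<le> \<dots> \<le> T - t\<^sub>1\<close>. Finiteness of the state space is part of the definition because
  sums over the state space and the matrix exponential above presuppose it.\<close>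

definition time_reversible :: "'s ctmc \<Rightarrow> bool" where
  "time_reversible M \<longleftrightarrow> finite (fst M) \<and> (\<exists>!p. steady_state M p) \<and>
     (\<forall>p. steady_state M p \<longrightarrow>
       (\<forall>T xs. sorted (map fst xs) \<and> set xs \<subseteq> {0..T} \<times> fst M \<longrightarrow>
          joint_prob M p xs = joint_prob M p (rev (map (\<lambda>(t, s). (T - t, s)) xs))))"


section \<open>The underlying chain of a process\<close>

definition ftrans ::
  "('a, 'k) proc set \<Rightarrow> 'a \<times> real \<Rightarrow> ('a, 'k) proc set \<Rightarrow> bool" where
  "ftrans s x s' \<longleftrightarrow> (\<exists>S S' i. S \<in> reachable_procs \<and> S' \<in> reachable_procs \<and>
     s = kclass S \<and> s' = kclass S' \<and> fstep S (fst x, snd x, i) S')"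

definition btrans ::
  "(real \<Rightarrow> real) \<Rightarrow> ('a, 'k) proc set \<Rightarrow> 'a \<times> real \<Rightarrow> ('a, 'k) proc set \<Rightarrow> bool" where
  "btrans bw s x s' \<longleftrightarrow> (\<exists>S S' i. S \<in> reachable_procs \<and> S' \<in> reachable_procs \<and>
     s = kclass S \<and> s' = kclass S' \<and> bstep bw S (fst x, snd x, i) S')"

definition ctmc_states :: "(real \<Rightarrow> real) \<Rightarrow> ('a, 'k) proc \<Rightarrow> ('a, 'k) proc set set" where
  "ctmc_states bw R = {s. (\<lambda>u v. \<exists>x. ftrans u x v \<or> btrans bw u x v)\<^sup>*\<^sup>* (kclass R) s}"

definition ctmc_rate ::
  "(real \<Rightarrow> real) \<Rightarrow> ('a, 'k) proc set \<Rightarrow> ('a, 'k) proc set \<Rightarrow> real" where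
  "ctmc_rate bw s s' =
     (\<Sum>\<^sub>\<infinity>x\<in>{x. ftrans s x s'}. snd x) + (\<Sum>\<^sub>\<infinity>x\<in>{x. btrans bw s x s'}. snd x)"

definition underlying_ctmc :: "(real \<Rightarrow> real) \<Rightarrow> ('a, 'k) proc \<Rightarrow> ('a, 'k) proc set ctmc" where
  "underlying_ctmc bw R = (ctmc_states bw R, ctmc_rate bw)"

end

theory Submission imports Defs "HOL-Combinatorics.Transposition" begin

text \<open>Without parallel composition the executed prefixes of a reachable process form one sequence
  of labels \<open>(a\<^sub>1, l\<^sub>1), \<dots>, (a\<^sub>n, l\<^sub>n)\<close>. This sequence is invariant under renaming of keys, a forward
  transition appends its label, and a backward transition removes the last one. Hence two distinct
  classes are joined by at most one forward transition, its reversal has rate \<open>bw l\<close>, and the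
  weight \<open>l\<^sub>1 / bw l\<^sub>1 * \<dots> * l\<^sub>n / bw l\<^sub>n\<close> satisfies detailed balance. A finite irreducible chain in
  detailed balance with a positive weight is time reversible, the normalised weight being its
  steady state. The chain is finite because all its states have the same unexecuted form and
  are represented by processes with keys in a fixed finite set.\<close>

section \<open>Finite chains in detailed balance\<close>

locale reversible_chain =
  fixes M :: "'s ctmc" and w :: "'s \<Rightarrow> real"
  assumes finite_states: "finite (fst M)"
    and nonempty: "fst M \<noteq> {}"
    and weight_pos: "s \<in> fst M \<Longrightarrow> w s > 0"
    and rate_nonneg: "s \<in> fst M \<Longrightarrow> s' \<in> fst M \<Longrightarrow> s \<noteq> s' \<Longrightarrow> snd M s s' \<ge> 0"
    and detailed_balance:
      "s \<in> fst M \<Longrightarrow> s' \<in> fst M \<Longrightarrow> s \<noteq> s' \<Longrightarrow> w s * snd M s s' = w s' * snd M s' s"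
    and irreducible: "s \<in> fst M \<Longrightarrow> s' \<in> fst M \<Longrightarrow>
      (\<lambda>u v. u \<in> fst M \<and> v \<in> fst M \<and> u \<noteq> v \<and> snd M u v > 0)\<^sup>*\<^sup>* s s'"
begin

section \<open>Detailed balance for the generator, its powers and its exponential\<close>

lemma generator_balance:
  assumes "s \<in> fst M" "s' \<in> fst M"
  shows "w s * generator M s s' = w s' * generator M s' s"
  using detailed_balance[OF assms] by (auto simp: generator_def)

lemma generator_row_sum:
  assumes "s \<in> fst M"
  shows "(\<Sum>u\<in>fst M. generator M s u) = 0"
proof -
  have "(\<Sum>u\<in>fst M. generator M s u) = generator M s s + (\<Sum>u\<in>fst M - {s}. generator M s u)"
    using finite_states assms by (rule sum.remove)
  also have "(\<Sum>u\<in>fst M - {s}. generator M s u) = (\<Sum>u\<in>fst M - {s}. snd M s u)"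
    by (rule sum.cong) (auto simp: generator_def)
  finally show ?thesis by (simp add: generator_def)
qed

text \<open>Transposing a matrix product reverses its factors, so detailed balance turns the left
  recursion of \<open>generator_power\<close> into this right one.\<close>

lemma generator_power_Suc_right:
  assumes "s \<in> fst M" "s' \<in> fst M"
  shows "generator_power M (Suc n) s s' = (\<Sum>u\<in>fst M. generator_power M n s u * generator M u s')"
  using assms(1)
proof (induction n arbitrary: s)
  case 0
  then show ?case
    using finite_states assms(2)
    by (simp add: if_distrib[of "\<lambda>x. _ * x"] if_distrib[of "\<lambda>x. x * _"] cong: if_cong)
next
  case (Suc n)
  have "generator_power M (Suc (Suc n)) s s'
      = (\<Sum>u\<in>fst M. generator M s u * (\<Sum>v\<in>fst M. generator_power M n u v * generator M v s'))"
    using Suc.IH by (simp del: generator_power.simps(2) add: generator_power.simps(2)[of M "Suc n"])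
  also have "\<dots> = (\<Sum>v\<in>fst M. \<Sum>u\<in>fst M. generator M s u * (generator_power M n u v * generator M v s'))"
    unfolding sum_distrib_left by (rule sum.swap)
  also have "\<dots> = (\<Sum>v\<in>fst M. generator_power M (Suc n) s v * generator M v s')"
    by (simp add: sum_distrib_right mult.assoc)
  finally show ?case .
qed

text \<open>Detailed balance makes the generator self-adjoint for the inner product weighted by
  \<open>w\<close>, and powers inherit this: \<open>w\<close> is passed first through one factor,
  then by induction through the rest.\<close>

lemma generator_power_balance:
  assumes "s \<in> fst M" "s' \<in> fst M"
  shows "w s * generator_power M n s s' = w s' * generator_power M n s' s"
  using assms
proof (induction n arbitrary: s s')
  case (Suc n)
  have "w s * generator_power M (Suc n) s s'
      = (\<Sum>u\<in>fst M. (w s * generator M s u) * generator_power M n u s')"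
    by (simp add: sum_distrib_left mult.assoc)
  also have "\<dots> = (\<Sum>u\<in>fst M. (w u * generator_power M n u s') * generator M u s)"
    using Suc.prems by (intro sum.cong) (auto simp: generator_balance)
  also have "\<dots> = (\<Sum>u\<in>fst M. w s' * (generator_power M n s' u * generator M u s))"
    using Suc by (intro sum.cong) (auto simp: mult.assoc)
  also have "\<dots> = w s' * generator_power M (Suc n) s' s"
    unfolding generator_power_Suc_right[OF Suc.prems(2,1)] by (simp add: sum_distrib_left)
  finally show ?case .
qed simp

text \<open>The sum of all absolute entries is a submultiplicative norm. It dominates the
  exponential series by that of a scalar, and summability lets \<open>w\<close> be moved into the
  series.\<close>

lemma generator_power_bound:
  assumes "s \<in> fst M"
  shows "\<bar>generator_power M n s s'\<bar> \<le> (\<Sum>u\<in>fst M. \<Sum>v\<in>fst M. \<bar>generator M u v\<bar>) ^ n"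
  using assms
proof (induction n arbitrary: s)
  case (Suc n)
  let ?c = "\<Sum>u\<in>fst M. \<Sum>v\<in>fst M. \<bar>generator M u v\<bar>"
  have c: "?c \<ge> 0" by (intro sum_nonneg) auto
  have "\<bar>generator_power M (Suc n) s s'\<bar>
      \<le> (\<Sum>u\<in>fst M. \<bar>generator M s u * generator_power M n u s'\<bar>)"
    by (simp add: sum_abs)
  also have "\<dots> \<le> (\<Sum>u\<in>fst M. \<bar>generator M s u\<bar> * ?c ^ n)"
    unfolding abs_mult using Suc.IH by (intro sum_mono mult_left_mono) auto
  also have "\<dots> = (\<Sum>u\<in>fst M. \<bar>generator M s u\<bar>) * ?c ^ n"
    by (simp add: sum_distrib_right)
  also have "\<dots> \<le> ?c * ?c ^ n"
    using Suc.prems finite_states c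
    by (intro mult_right_mono member_le_sum[of s "fst M" "\<lambda>u. \<Sum>v\<in>fst M. \<bar>generator M u v\<bar>"])
       (auto intro: sum_nonneg)
  finally show ?case by simp
qed simp

lemma summable_transition_prob:
  assumes "s \<in> fst M"
  shows "summable (\<lambda>n. t ^ n / fact n * generator_power M n s s')"
proof (rule summable_comparison_test')
  let ?c = "\<Sum>u\<in>fst M. \<Sum>v\<in>fst M. \<bar>generator M u v\<bar>"
  show "summable (\<lambda>n. inverse (fact n) * (\<bar>t\<bar> * ?c) ^ n)"
    by (rule summable_exp)
  show "norm (t ^ n / fact n * generator_power M n s s') \<le> inverse (fact n) * (\<bar>t\<bar> * ?c) ^ n"
    if "n \<ge> 0" for n
  proof -
    have "norm (t ^ n / fact n * generator_power M n s s')
        = \<bar>t\<bar> ^ n / fact n * \<bar>generator_power M n s s'\<bar>"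
      by (simp add: abs_mult power_abs)
    also have "\<dots> \<le> \<bar>t\<bar> ^ n / fact n * ?c ^ n"
      using generator_power_bound[OF assms] by (intro mult_left_mono) auto
    finally show ?thesis by (simp add: power_mult_distrib field_simps)
  qed
qed

lemma transition_prob_balance:
  assumes "s \<in> fst M" "s' \<in> fst M"
  shows "w s * transition_prob M t s s' = w s' * transition_prob M t s' s"
proof -
  have "w s * transition_prob M t s s' = (\<Sum>n. w s * (t ^ n / fact n * generator_power M n s s'))"
    unfolding transition_prob_def
    by (rule suminf_mult[symmetric]) (rule summable_transition_prob[OF assms(1)])
  also have "\<dots> = (\<Sum>n. w s' * (t ^ n / fact n * generator_power M n s' s))"
    using generator_power_balance[OF assms] by (simp add: mult.left_commute[of "w _"])
  also have "\<dots> = w s' * transition_prob M t s' s"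
    unfolding transition_prob_def
    by (rule suminf_mult) (rule summable_transition_prob[OF assms(2)])
  finally show ?thesis .
qed

text \<open>Maximum principle: every neighbour of a state where \<open>h\<close> is maximal is again such a state.\<close>

lemma harmonic_constant:
  assumes harm: "\<And>s. s \<in> fst M \<Longrightarrow> (\<Sum>u\<in>fst M. generator M s u * h u) = 0"
    and "s \<in> fst M" "s' \<in> fst M"
  shows "h s = h s'"
proof -
  define m where "m = Max (h ` fst M)"
  have fin: "finite (h ` fst M)" "h ` fst M \<noteq> {}"
    using finite_states nonempty by auto
  have le: "h u \<le> m" if "u \<in> fst M" for u
    using that fin unfolding m_def by simp
  obtain z where z: "z \<in> fst M" "h z = m"
    using Max_in[OF fin] unfolding m_def by auto
  have step: "h v = m"
    if uv: "u \<in> fst M" "v \<in> fst M" "u \<noteq> v" "snd M u v > 0" and hu: "h u = m" for u v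
  proof -
    \<comment> \<open>Off the diagonal both factors are nonnegative, and for \<open>x = u\<close>
      the second one vanishes. As these terms sum to zero, each of them is zero.\<close>
    have nonneg: "0 \<le> generator M u x * (m - h x)" if "x \<in> fst M" for x
      using that hu le[OF that] rate_nonneg[OF uv(1) that]
      by (cases "x = u") (auto simp: generator_def)
    have "(\<Sum>x\<in>fst M. generator M u x * (m - h x))
        = (\<Sum>x\<in>fst M. generator M u x) * m - (\<Sum>x\<in>fst M. generator M u x * h x)"
      by (simp add: right_diff_distrib sum_subtractf sum_distrib_right)
    then have "(\<Sum>x\<in>fst M. generator M u x * (m - h x)) = 0"
      using generator_row_sum[OF uv(1)] harm[OF uv(1)] by simp
    then have "generator M u v * (m - h v) = 0"
      using uv(2) sum_nonneg_eq_0_iff[of "fst M" "\<lambda>x. generator M u x * (m - h x)"]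
        finite_states nonneg by simp
    then show ?thesis using uv by (simp add: generator_def)
  qed
  have "h u = m" if "u \<in> fst M" for u
    using irreducible[OF z(1) that] z(2)
    by (induction rule: rtranclp_induct) (use step in auto)
  then show ?thesis using assms(2,3) by simp
qed

section \<open>Existence and uniqueness of the steady state\<close>

definition stationary :: "'s \<Rightarrow> real" where
  "stationary s = (if s \<in> fst M then w s / (\<Sum>u\<in>fst M. w u) else 0)"

lemma weight_sum_pos: "(\<Sum>u\<in>fst M. w u) > 0"
  using finite_states nonempty weight_pos by (rule sum_pos)

text \<open>By detailed balance the density \<open>h\<close> of a steady state with respect to
  \<open>w\<close> is harmonic, hence constant, and total mass 1 fixes the constant. Conversely,
  balance turns the column sums of the steady-state equation into row sums of the generator.\<close>

lemma steady_state_iff: "steady_state M p \<longleftrightarrow> pmf p = stationary"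
proof
  let ?Z = "\<Sum>u\<in>fst M. w u"
  assume p: "steady_state M p"
  define h where "h s = pmf p s / w s" for s
  have p_eq: "pmf p s = w s * h s" if "s \<in> fst M" for s
    using weight_pos[OF that] by (simp add: h_def)
  have harm: "(\<Sum>u\<in>fst M. generator M s u * h u) = 0" if s: "s \<in> fst M" for s
  proof -
    have "w s * (\<Sum>u\<in>fst M. generator M s u * h u)
        = (\<Sum>u\<in>fst M. (w s * generator M s u) * h u)"
      by (simp add: sum_distrib_left mult.assoc)
    also have "\<dots> = (\<Sum>u\<in>fst M. pmf p u * generator M u s)"
      using generator_balance[OF s] by (intro sum.cong) (auto simp: p_eq)
    also have "\<dots> = 0" using p s by (simp add: steady_state_def)
    finally show ?thesis using weight_pos[OF s] by simp
  qed
  show "pmf p = stationary"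
  proof
    fix s
    show "pmf p s = stationary s"
    proof (cases "s \<in> fst M")
      case True
      have "1 = (\<Sum>u\<in>fst M. pmf p u)"
        using p finite_states by (simp add: steady_state_def sum_pmf_eq_1)
      also have "\<dots> = (\<Sum>u\<in>fst M. w u * h s)"
        using harmonic_constant[OF harm _ True] by (intro sum.cong) (auto simp: p_eq)
      finally have "?Z * h s = 1"
        by (simp add: sum_distrib_right)
      then have "h s = 1 / ?Z"
        using weight_sum_pos by (simp add: field_simps)
      then show ?thesis using True by (simp add: stationary_def p_eq)
    next
      case False
      then show ?thesis using p by (auto simp: steady_state_def stationary_def pmf_eq_0_set_pmf)
    qed
  qed
next
  assume p: "pmf p = stationary"
  have "set_pmf p \<subseteq> fst M"
    by (auto simp: set_pmf_eq p stationary_def split: if_splits)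
  moreover have "(\<Sum>s\<in>fst M. pmf p s * generator M s s') = 0" if s': "s' \<in> fst M" for s'
  proof -
    have "(\<Sum>s\<in>fst M. pmf p s * generator M s s')
        = (\<Sum>s\<in>fst M. w s' * generator M s' s / (\<Sum>u\<in>fst M. w u))"
      using generator_balance[OF s'] by (intro sum.cong) (auto simp: p stationary_def)
    also have "\<dots> = w s' * (\<Sum>s\<in>fst M. generator M s' s) / (\<Sum>u\<in>fst M. w u)"
      by (simp add: sum_divide_distrib sum_distrib_left)
    finally show ?thesis using generator_row_sum[OF s'] by simp
  qed
  ultimately show "steady_state M p" by (simp add: steady_state_def)
qed

lemma ex1_steady_state: "\<exists>!p. steady_state M p"
proof -
  have nonneg: "stationary s \<ge> 0" for s
    using weight_pos[of s] weight_sum_pos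
    by (auto simp: stationary_def zero_le_divide_iff less_imp_le)
  have "(\<integral>\<^sup>+ s. ennreal (stationary s) \<partial>count_space UNIV) = (\<Sum>s\<in>fst M. ennreal (stationary s))"
    using finite_states by (intro nn_integral_count_space') (auto simp: stationary_def)
  also have "\<dots> = ennreal (\<Sum>s\<in>fst M. stationary s)"
    using nonneg by (intro sum_ennreal) auto
  also have "(\<Sum>s\<in>fst M. stationary s) = 1"
    using weight_sum_pos by (simp add: stationary_def sum_divide_distrib[symmetric])
  finally have "pmf (embed_pmf stationary) s = stationary s" for s
    using nonneg by (intro pmf_embed_pmf) auto
  then have "steady_state M (embed_pmf stationary)"
    by (auto simp: steady_state_iff)
  moreover have "p = p'" if "steady_state M p" "steady_state M p'" for p p'
    using that by (intro pmf_eqI) (simp add: steady_state_iff)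
  ultimately show ?thesis by blast
qed

section \<open>Joint distributions under time reversal\<close>

lemma path_prob_snoc:
  "path_prob M x (xs @ [y]) = path_prob M x xs *
     transition_prob M (fst y - fst (last (x # xs))) (snd (last (x # xs))) (snd y)"
proof (induction xs arbitrary: x)
  case Nil
  then show ?case by (cases x; cases y) simp
next
  case (Cons z xs)
  then show ?case by (cases x; cases z) simp
qed

lemma joint_prob_snoc:
  "xs \<noteq> [] \<Longrightarrow> joint_prob M p (xs @ [y]) = joint_prob M p xs *
     transition_prob M (fst y - fst (last xs)) (snd (last xs)) (snd y)"
proof (cases xs)
  case (Cons z zs)
  then show ?thesis
    using path_prob_snoc[of z zs y] by (cases z) simp
qed simp

text \<open>Balance moves the initial probability from \<open>x\<close> to \<open>y\<close> and
  reverses the first transition, which leaves a joint probability that starts at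
  \<open>y\<close>.\<close>

lemma joint_prob_Cons:
  assumes "steady_state M p" "set (x # y # xs) \<subseteq> UNIV \<times> fst M"
  shows "joint_prob M p (x # y # xs) =
    transition_prob M (fst y - fst x) (snd y) (snd x) * joint_prob M p (y # xs)"
proof -
  obtain t s t' s' where xy: "x = (t, s)" "y = (t', s')" by (cases x; cases y)
  have s: "s \<in> fst M" "s' \<in> fst M" using assms(2) xy by auto
  have "pmf p s * transition_prob M u s s' = pmf p s' * transition_prob M u s' s" for u
    using transition_prob_balance[OF s, of u] assms(1) s
    by (simp add: steady_state_iff stationary_def)
  then show ?thesis by (simp add: xy mult_ac)
qed

text \<open>Reversal sends the head \<open>x\<close> to the end of the list, where it contributes
  exactly the factor that \<open>joint_prob_Cons\<close> splits off; the elapsed times agree because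
  \<open>T\<close> cancels.\<close>

lemma joint_prob_reversal:
  assumes "steady_state M p" "set xs \<subseteq> UNIV \<times> fst M"
  shows "joint_prob M p (rev (map (\<lambda>(t, s). (T - t, s)) xs)) = joint_prob M p xs"
  using assms(2)
proof (induction xs rule: induct_list012)
  case (3 x y zs)
  let ?r = "\<lambda>(t, s). (T - t, s)"
  have "joint_prob M p (rev (map ?r (x # y # zs))) = joint_prob M p (rev (map ?r (y # zs)) @ [?r x])"
    by simp
  also have "\<dots> = joint_prob M p (rev (map ?r (y # zs))) *
      transition_prob M (fst (?r x) - fst (?r y)) (snd (?r y)) (snd (?r x))"
    by (subst joint_prob_snoc) simp_all
  also have "\<dots> = transition_prob M (fst y - fst x) (snd y) (snd x) * joint_prob M p (y # zs)"
    using 3 by (cases x; cases y) simp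
  also have "\<dots> = joint_prob M p (x # y # zs)"
    using joint_prob_Cons[OF assms(1) "3.prems"] by simp
  finally show ?case .
qed auto

theorem time_reversible: "time_reversible M"
proof -
  have "joint_prob M p xs = joint_prob M p (rev (map (\<lambda>(t, s). (T - t, s)) xs))"
    if "steady_state M p" "set xs \<subseteq> {0..T} \<times> fst M" for p T xs
    using that joint_prob_reversal[of p xs T] by fastforce
  then show ?thesis
    using finite_states ex1_steady_state by (auto simp: time_reversible_def)
qed

end

section \<open>Invariants of processes\<close>

text \<open>For a reachable process this is the forward process it started from; transitions and key
  renamings leave it unchanged.\<close>

primrec unexec :: "('a, 'k) proc \<Rightarrow> ('a, 'k) proc" where
  "unexec Stop = Stop"
| "unexec (Pre a l P) = Pre a l (unexec P)"
| "unexec (Exec a l i R) = Pre a l (unexec R)"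
| "unexec (Cho R S) = Cho (unexec R) (unexec S)"
| "unexec (Par L R S) = Par L (unexec R) (unexec S)"

primrec exec_labels :: "('a, 'k) proc \<Rightarrow> ('a \<times> real) list" where
  "exec_labels Stop = []"
| "exec_labels (Pre a l P) = exec_labels P"
| "exec_labels (Exec a l i R) = (a, l) # exec_labels R"
| "exec_labels (Cho R S) = exec_labels R @ exec_labels S"
| "exec_labels (Par L R S) = exec_labels R @ exec_labels S"

text \<open>Contexts cannot pass an unexecuted prefix, so a key below one would be out of reach of
  \<open>nosync\<close>; hence the condition for \<open>Pre\<close>.\<close>

primrec distinct_keys :: "('a, 'k) proc \<Rightarrow> bool" where
  "distinct_keys Stop = True"
| "distinct_keys (Pre a l P) = (keys P = {})"
| "distinct_keys (Exec a l i R) = (i \<notin> keys R \<and> distinct_keys R)"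
| "distinct_keys (Cho R S) = (keys R \<inter> keys S = {} \<and> distinct_keys R \<and> distinct_keys S)"
| "distinct_keys (Par L R S) = (distinct_keys R \<and> distinct_keys S)"

lemma std_simps:
  assumes "std P"
  shows "unexec P = P" "exec_labels P = []" "keys P = {}" "distinct_keys P"
  using assms by (induction P) auto

lemma par_free_unexec [simp]: "par_free (unexec R) = par_free R"
  by (induction R) auto

lemma exec_labels_pos: "std (unexec R) \<Longrightarrow> (a, l) \<in> set (exec_labels R) \<Longrightarrow> l > 0"
  by (induction R) auto

lemma finite_keys: "finite (keys R)"
  by (induction R) auto

lemma card_keys_le: "card (keys R) \<le> size (unexec R)"
proof (induction R)
  case (Exec a l i R)
  then show ?case using card_insert_le_m1[of "Suc (size (unexec R))" "keys R" i] by simp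
next
  case (Cho R S)
  then show ?case using card_Un_le[of "keys R" "keys S"] by simp
next
  case (Par L R S)
  then show ?case using card_Un_le[of "keys R" "keys S"] by simp
qed auto

lemma fstep_unexec: "fstep R x S \<Longrightarrow> unexec S = unexec R"
  by (induction rule: fstep.induct) auto

text \<open>A summand moves only if the other one is \<open>std\<close> and so contributes no
  labels; the new label therefore comes last even when the left summand moves.\<close>

lemma fstep_exec_labels:
  "fstep R x S \<Longrightarrow> par_free R \<Longrightarrow> exec_labels S = exec_labels R @ [(fst x, fst (snd x))]"
  by (induction rule: fstep.induct) (auto simp: std_simps)

lemma fstep_keys:
  "fstep R x S \<Longrightarrow> par_free R \<Longrightarrow> keys S = insert (snd (snd x)) (keys R) \<and> snd (snd x) \<notin> keys R"
  by (induction rule: fstep.induct) (auto simp: std_simps)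

lemma fstep_distinct_keys:
  "fstep R x S \<Longrightarrow> par_free R \<Longrightarrow> distinct_keys R \<Longrightarrow> distinct_keys S"
  by (induction rule: fstep.induct) (auto simp: std_simps dest: fstep_keys)

text \<open>Every rule has a mirror image. Without \<open>Coo\<close> a label carries the rate of
  one prefix, so that the backward rate is \<open>bw\<close> of the forward one; in a cooperation,
  \<open>bw\<close> would be applied to each factor.\<close>

lemma fstep_imp_bstep:
  "fstep R x S \<Longrightarrow> par_free R \<Longrightarrow> bstep bw S (fst x, bw (fst (snd x)), snd (snd x)) R"
  by (induction rule: fstep.induct) (auto intro: bstep.intros)

text \<open>\<open>bw\<close> may fail to be injective, so \<open>l\<close> is read off the prefix
  that is undone and not off the backward label.\<close>

lemma bstep_imp_fstep:
  "bstep bw S x R \<Longrightarrow> par_free S \<Longrightarrow> \<exists>l. fst (snd x) = bw l \<and> fstep R (fst x, l, snd (snd x)) S"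
  by (induction rule: bstep.induct) (auto intro: fstep.intros)

lemma bstep_unexec: "bstep bw S x R \<Longrightarrow> unexec S = unexec R"
  by (induction rule: bstep.induct) auto

lemma reachable_induct [consumes 1, case_names std fstep]:
  assumes "R \<in> reachable_procs"
    and "\<And>P. std P \<Longrightarrow> Q P"
    and "\<And>S x S'. S \<in> reachable_procs \<Longrightarrow> Q S \<Longrightarrow> fstep S x S' \<Longrightarrow> Q S'"
  shows "Q R"
proof -
  obtain P where P: "std P" and run: "(\<lambda>S S'. \<exists>x. fstep S x S')\<^sup>*\<^sup>* P R"
    using assms(1) by (auto simp: reachable_procs_def)
  from run show ?thesis
  proof (induction rule: rtranclp_induct)
    case base
    then show ?case using P assms(2) by blast
  next
    case (step S S')
    then show ?case using P assms(3)[of S _ S'] by (auto simp: reachable_procs_def)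
  qed
qed

lemma reachable_std: "std P \<Longrightarrow> P \<in> reachable_procs"
  by (auto simp: reachable_procs_def)

lemma reachable_fstep: "R \<in> reachable_procs \<Longrightarrow> fstep R x S \<Longrightarrow> S \<in> reachable_procs"
  unfolding reachable_procs_def by (blast intro: rtranclp.rtrancl_into_rtrancl)

lemma std_unexec_reachable: "R \<in> reachable_procs \<Longrightarrow> std (unexec R)"
  by (induction rule: reachable_induct) (auto simp: std_simps fstep_unexec)

lemma distinct_keys_reachable: "R \<in> reachable_procs \<Longrightarrow> par_free R \<Longrightarrow> distinct_keys R"
proof (induction rule: reachable_induct)
  case (fstep S x S')
  then show ?case
    by (metis fstep_distinct_keys fstep_unexec par_free_unexec)
qed (rule std_simps)

section \<open>Renaming of keys\<close>

text \<open>\<open>map_proc\<close> renames keys only: the action type occurs under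
  \<open>set\<close>, which makes it a dead parameter.\<close>

lemma keys_map_proc: "keys (map_proc f R) = f ` keys R"
  by (induction R) auto

lemma std_map_proc [simp]: "std (map_proc f R) = std R"
  by (induction R) auto


lemma fstep_map_proc:
  assumes "inj f" "fstep R x S"
  shows "fstep (map_proc f R) (fst x, fst (snd x), f (snd (snd x))) (map_proc f S)"
  using assms(2)
proof (induction rule: fstep.induct)
  case (Act2 R b m j R' i a l)
  then show ?case using \<open>inj f\<close> by (auto intro!: fstep.intros dest: injD)
qed (use \<open>inj f\<close> in \<open>auto intro!: fstep.intros simp: keys_map_proc inj_image_mem_iff\<close>)

lemma reachable_map_proc:
  assumes "inj f" "R \<in> reachable_procs"
  shows "map_proc f R \<in> reachable_procs"
  using assms(2)
  by (induction rule: reachable_induct)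
     (auto intro: reachable_std reachable_fstep fstep_map_proc[OF assms(1)])

lemma map_proc_transpose_fresh:
  "i \<notin> keys R \<Longrightarrow> j \<notin> keys R \<Longrightarrow> map_proc (Transposition.transpose i j) R = R"
  by (induction R) (auto simp: Transposition.transpose_def)

lemma par_free_plug: "par_free (plug C R) \<Longrightarrow> ctx_sync_acts C = {} \<and> par_free R"
proof -
  have sync: "par_free S \<Longrightarrow> sync_acts S = {}" for S :: "('a, 'k) proc"
    by (induction S) auto
  then show "par_free (plug C R) \<Longrightarrow> ctx_sync_acts C = {} \<and> par_free R"
    by (induction C) auto
qed

text \<open>Since \<open>i\<close> occurs once and \<open>j\<close> not at all, the transposition
  changes a single prefix, and a context isolates it in the form required by rule
  \<open>nosync\<close>.\<close>

lemma distinct_keys_decompose: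
  assumes "par_free S" "distinct_keys S" "i \<in> keys S" "j \<notin> keys S"
  shows "\<exists>C a l R. S = plug C (Exec a l i R) \<and>
    map_proc (Transposition.transpose i j) S = plug C (Exec a l j R) \<and>
    i \<notin> ctx_keys C \<and> j \<notin> ctx_keys C \<and> i \<notin> keys R \<and> j \<notin> keys R"
  using assms
proof (induction S)
  case (Exec a l k R)
  show ?case
  proof (cases "k = i")
    case True
    with Exec.prems show ?thesis
      by (intro exI[of _ Hole] exI[of _ a] exI[of _ l] exI[of _ R])
         (auto simp: map_proc_transpose_fresh)
  next
    case False
    with Exec obtain C b m T where "R = plug C (Exec b m i T)"
      "map_proc (Transposition.transpose i j) R = plug C (Exec b m j T)"
      "i \<notin> ctx_keys C" "j \<notin> ctx_keys C" "i \<notin> keys T" "j \<notin> keys T"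
      by auto
    with False Exec.prems show ?thesis
      by (intro exI[of _ "CExec a l k C"] exI[of _ b] exI[of _ m] exI[of _ T])
         auto
  qed
next
  case (Cho R S)
  show ?case
  proof (cases "i \<in> keys R")
    case True
    with Cho obtain C b m T where "R = plug C (Exec b m i T)"
      "map_proc (Transposition.transpose i j) R = plug C (Exec b m j T)"
      "i \<notin> ctx_keys C" "j \<notin> ctx_keys C" "i \<notin> keys T" "j \<notin> keys T"
      by auto
    moreover have "i \<notin> keys S" using True Cho.prems by auto
    ultimately show ?thesis using Cho.prems
      by (intro exI[of _ "CChoL C S"] exI[of _ b] exI[of _ m] exI[of _ T])
         (auto simp: map_proc_transpose_fresh)
  next
    case False
    with Cho obtain C b m T where "S = plug C (Exec b m i T)"
      "map_proc (Transposition.transpose i j) S = plug C (Exec b m j T)"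
      "i \<notin> ctx_keys C" "j \<notin> ctx_keys C" "i \<notin> keys T" "j \<notin> keys T"
      by auto
    with False show ?thesis using Cho.prems
      by (intro exI[of _ "CChoR R C"] exI[of _ b] exI[of _ m] exI[of _ T])
         (auto simp: map_proc_transpose_fresh)
  qed
qed auto

text \<open>A transposition is used instead of substituting \<open>j\<close> for \<open>i\<close>
  because it is injective, so it maps the run reaching \<open>S\<close> to a run reaching the
  renamed process; this supplies the reachability demanded by \<open>nosync\<close>.\<close>

lemma keq_transpose:
  assumes "S \<in> reachable_procs" "par_free S" "i \<in> keys S" "j \<notin> keys S"
  shows "keq S (map_proc (Transposition.transpose i j) S)"
proof -
  obtain C a l R where S: "S = plug C (Exec a l i R)"
      "map_proc (Transposition.transpose i j) S = plug C (Exec a l j R)"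
      "i \<notin> ctx_keys C" "j \<notin> ctx_keys C" "i \<notin> keys R" "j \<notin> keys R"
    using distinct_keys_decompose[OF assms(2) distinct_keys_reachable[OF assms(1,2)] assms(3,4)]
    by blast
  have "map_proc (Transposition.transpose i j) S \<in> reachable_procs"
    using assms(1) by (rule reachable_map_proc[rotated]) simp
  then show ?thesis
    using assms(1,2) S par_free_plug[of C "Exec a l i R"] keq.nosync[of a C i j R l] by simp
qed

section \<open>Classes up to keys\<close>

lemma plug_cong:
  "unexec R = unexec S \<Longrightarrow> unexec (plug C R) = unexec (plug C S)"
  "exec_labels R = exec_labels S \<Longrightarrow> exec_labels (plug C R) = exec_labels (plug C S)"
  by (induction C) auto

lemma sync_rename_invariant:
  "sync_rename a i j R S \<Longrightarrow> unexec R = unexec S \<and> exec_labels R = exec_labels S"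
  by (induction rule: sync_rename.induct) (auto intro: plug_cong)

lemma keq_invariant:
  "keq R S \<Longrightarrow> unexec R = unexec S \<and> exec_labels R = exec_labels S"
proof (induction rule: keq.induct)
  case (sync a i j T T' U U' L C)
  then show ?case by (auto dest!: sync_rename_invariant intro!: plug_cong)
qed (auto intro: plug_cong)

lemma keq_reachable: "keq R S \<Longrightarrow> R \<in> reachable_procs \<and> S \<in> reachable_procs"
  by (induction rule: keq.induct) auto

lemma kclass_eq_iff:
  assumes "R \<in> reachable_procs"
  shows "kclass R = kclass S \<longleftrightarrow> keq R S"
  unfolding kclass_def using keq.refl[OF assms] keq.sym keq.trans by blast

lemma kclass_invariant:
  assumes "kclass R = kclass S" "R \<in> reachable_procs"
  shows "unexec R = unexec S" "exec_labels R = exec_labels S"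
  using keq_invariant assms by (auto simp: kclass_eq_iff)

section \<open>Finiteness of the set of classes\<close>

lemma finite_unexec_fibre:
  assumes "finite F"
  shows "finite {R :: ('a, 'k) proc. unexec R = P \<and> keys R \<subseteq> F}"
proof (induction P)
  case Stop
  have "{R :: ('a, 'k) proc. unexec R = Stop \<and> keys R \<subseteq> F} \<subseteq> {Stop}"
  proof
    fix R :: "('a, 'k) proc"
    assume "R \<in> {R. unexec R = Stop \<and> keys R \<subseteq> F}"
    then show "R \<in> {Stop}" by (cases R) auto
  qed
  then show ?case by (rule finite_subset) simp
next
  let ?A = "\<lambda>P. {R :: ('a, 'k) proc. unexec R = P \<and> keys R \<subseteq> F}"
  case (Pre a l P)
  have "?A (Pre a l P) \<subseteq> Pre a l ` ?A P \<union> (\<lambda>(i, R). Exec a l i R) ` (F \<times> ?A P)"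
  proof
    fix R assume "R \<in> ?A (Pre a l P)"
    then show "R \<in> Pre a l ` ?A P \<union> (\<lambda>(i, R). Exec a l i R) ` (F \<times> ?A P)" by (cases R) auto
  qed
  moreover have "finite (Pre a l ` ?A P \<union> (\<lambda>(i, R). Exec a l i R) ` (F \<times> ?A P))"
    using Pre assms by simp
  ultimately show ?case by (rule finite_subset)
next
  case (Exec a l i P)
  have "unexec R \<noteq> Exec a l i P" for R by (cases R) auto
  then show ?case by simp
next
  let ?A = "\<lambda>P. {R :: ('a, 'k) proc. unexec R = P \<and> keys R \<subseteq> F}"
  case (Cho P Q)
  have "?A (Cho P Q) \<subseteq> (\<lambda>(R, S). Cho R S) ` (?A P \<times> ?A Q)"
  proof
    fix R assume "R \<in> ?A (Cho P Q)"
    then show "R \<in> (\<lambda>(R, S). Cho R S) ` (?A P \<times> ?A Q)" by (cases R) auto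
  qed
  then show ?case by (rule finite_subset) (simp add: Cho)
next
  let ?A = "\<lambda>P. {R :: ('a, 'k) proc. unexec R = P \<and> keys R \<subseteq> F}"
  case (Par L P Q)
  have "?A (Par L P Q) \<subseteq> (\<lambda>(R, S). Par L R S) ` (?A P \<times> ?A Q)"
  proof
    fix R assume "R \<in> ?A (Par L P Q)"
    then show "R \<in> (\<lambda>(R, S). Par L R S) ` (?A P \<times> ?A Q)" by (cases R) auto
  qed
  then show ?case by (rule finite_subset) (simp add: Par)
qed

text \<open>A key can only be renamed to an unused one, hence the requirement that \<open>F\<close> has a spare key.
  If there are too few keys for this, processes that differ by a permutation of keys may lie in
  different classes, but then all keys together form a finite set.\<close>

lemma keq_keys_subset:
  assumes F: "F = UNIV \<or> finite F \<and> card F > size (unexec S)"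
    and "S \<in> reachable_procs" "par_free S"
  shows "\<exists>S'. keq S S' \<and> keys S' \<subseteq> F"
  using assms
proof (induction "card (keys S - F)" arbitrary: S rule: less_induct)
  case less
  show ?case
  proof (cases "keys S \<subseteq> F")
    case True
    then show ?thesis using keq.refl less.prems(2) by blast
  next
    case False
    then obtain i where i: "i \<in> keys S" "i \<notin> F" by blast
    \<comment> \<open>\<open>i \<notin> F\<close> excludes \<open>F = UNIV\<close>, so
      \<open>F\<close> has more elements than \<open>S\<close> has keys and contains a spare key
      \<open>j\<close>.\<close>
    then have "finite F" "card F > card (keys S)"
      using less.prems(1) card_keys_le[of S] by auto
    then obtain j where j: "j \<in> F" "j \<notin> keys S"
      by (metis card_mono finite_keys leD subsetI)
    let ?S = "map_proc (Transposition.transpose i j) S"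
    have eq: "keq S ?S" using less.prems i j by (intro keq_transpose)
    have inv: "unexec ?S = unexec S" using keq_invariant[OF eq] by simp
    have "keys ?S = insert j (keys S - {i})"
      using i j by (auto simp: keys_map_proc Transposition.transpose_def image_iff)
    then have "keys ?S - F = keys S - F - {i}" using j by auto
    then have "card (keys ?S - F) < card (keys S - F)"
      using i finite_keys[of S] by (simp add: card_Diff1_less del: card_Diff_insert card_Diff_singleton)
    then have "\<exists>S'. keq ?S S' \<and> keys S' \<subseteq> F"
      using less.hyps[of ?S] less.prems inv keq_reachable[OF eq] par_free_unexec[of ?S]
      by simp
    then show ?thesis using eq keq.trans by blast
  qed
qed

lemma finite_kclasses:
  "finite {kclass S | S :: ('a, 'k) proc. S \<in> reachable_procs \<and> par_free S \<and> unexec S = P}"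
proof -
  \<comment> \<open>If there are infinitely many keys, \<open>size P + 1\<close> of them give the
    strict inequality of \<open>keq_keys_subset\<close>; otherwise \<open>F\<close> consists of all
    keys.\<close>
  obtain F :: "'k set" where F: "finite F" "F = UNIV \<or> finite F \<and> card F > size P"
  proof (cases "finite (UNIV :: 'k set)")
    case False
    then obtain F :: "'k set" where "finite F" "card F = Suc (size P)"
      using infinite_arbitrarily_large by blast
    then show ?thesis using that by simp
  qed (rule that[of UNIV]; simp)
  have "{kclass S | S :: ('a, 'k) proc. S \<in> reachable_procs \<and> par_free S \<and> unexec S = P}
      \<subseteq> kclass ` {S. unexec S = P \<and> keys S \<subseteq> F}"
  proof clarify
    fix S :: "('a, 'k) proc"
    assume S: "S \<in> reachable_procs" "par_free S" "P = unexec S"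
    then obtain S' where S': "keq S S'" "keys S' \<subseteq> F"
      using keq_keys_subset[of F S] F(2) by auto
    have "kclass S = kclass S'" using kclass_eq_iff[OF S(1)] S'(1) by simp
    moreover have "unexec S' = unexec S" using keq_invariant[OF S'(1)] by simp
    ultimately show "kclass S \<in> kclass ` {S'. unexec S' = unexec S \<and> keys S' \<subseteq> F}"
      using S'(2) by simp
  qed
  then show ?thesis
    by (rule finite_subset) (intro finite_imageI finite_unexec_fibre F(1))
qed

section \<open>Rates between classes\<close>

definition par_free_class :: "('a, 'k) proc set \<Rightarrow> bool" where
  "par_free_class s \<longleftrightarrow> (\<exists>S \<in> reachable_procs. par_free S \<and> s = kclass S)"

definition class_labels :: "('a, 'k) proc set \<Rightarrow> ('a \<times> real) list" where
  "class_labels s = exec_labels (SOME S. S \<in> s)"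

lemma class_labels_kclass [simp]:
  assumes "S \<in> reachable_procs"
  shows "class_labels (kclass S) = exec_labels S"
proof -
  have "S \<in> kclass S" using keq.refl[OF assms] by (simp add: kclass_def)
  then have "(SOME T. T \<in> kclass S) \<in> kclass S" by (rule someI)
  then have "keq S (SOME T. T \<in> kclass S)" by (simp add: kclass_def)
  then show ?thesis using keq_invariant by (metis class_labels_def)
qed

text \<open>The unexecuted form is shared by a whole class and determines whether a parallel
  operator occurs, so one par-free representative suffices.\<close>

lemma par_free_rep:
  assumes "par_free_class (kclass S)" "S \<in> reachable_procs"
  shows "par_free S"
proof -
  obtain T where "par_free T" "kclass S = kclass T"
    using assms(1) by (auto simp: par_free_class_def)
  then show ?thesis using kclass_invariant(1)[OF _ assms(2), of T]
      par_free_unexec[of S] par_free_unexec[of T] by simp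
qed

lemma ftrans_class_labels:
  assumes "par_free_class s" "ftrans s x s'"
  shows "class_labels s' = class_labels s @ [x]"
proof -
  obtain S S' i where S: "S \<in> reachable_procs" "S' \<in> reachable_procs"
      "s = kclass S" "s' = kclass S'" "fstep S (fst x, snd x, i) S'"
    using assms(2) by (auto simp: ftrans_def)
  then show ?thesis using fstep_exec_labels[OF S(5)] par_free_rep[of S] assms(1) by simp
qed

lemma ftrans_rate_pos:
  assumes "par_free_class s" "ftrans s (a, l) s'"
  shows "l > 0"
proof -
  obtain S S' i where S: "S' \<in> reachable_procs" "s' = kclass S'"
    using assms(2) by (auto simp: ftrans_def)
  have "(a, l) \<in> set (exec_labels S')"
    using ftrans_class_labels[OF assms] S by simp
  then show ?thesis by (rule exec_labels_pos[OF std_unexec_reachable[OF S(1)]])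
qed

lemma btrans_iff_ftrans:
  assumes "par_free_class s" "par_free_class s'"
  shows "btrans bw s' (a, r) s \<longleftrightarrow> (\<exists>l. r = bw l \<and> ftrans s (a, l) s')"
proof
  assume "btrans bw s' (a, r) s"
  then obtain S S' i where S: "S \<in> reachable_procs" "S' \<in> reachable_procs"
      "s = kclass S" "s' = kclass S'" "bstep bw S' (a, r, i) S"
    by (auto simp: btrans_def)
  then show "\<exists>l. r = bw l \<and> ftrans s (a, l) s'"
    using bstep_imp_fstep[OF S(5)] par_free_rep[of S'] assms(2) by (auto simp: ftrans_def)
next
  assume "\<exists>l. r = bw l \<and> ftrans s (a, l) s'"
  then obtain l S S' i where S: "r = bw l" "S \<in> reachable_procs" "S' \<in> reachable_procs"
      "s = kclass S" "s' = kclass S'" "fstep S (a, l, i) S'"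
    by (auto simp: ftrans_def)
  then show "btrans bw s' (a, r) s"
    using fstep_imp_bstep[OF S(6)] par_free_rep[of S] assms(1) by (auto simp: btrans_def)
qed

text \<open>The label sequences of the two classes determine the label \<open>(a, l)\<close> and
  exclude a forward transition back, which would have to lengthen the sequence again. Each rate is
  thus a sum over one singleton and one empty set.\<close>

lemma ctmc_rate_ftrans:
  assumes "par_free_class s" "par_free_class s'" "ftrans s (a, l) s'"
  shows "ctmc_rate bw s s' = l" "ctmc_rate bw s' s = bw l"
proof -
  have labels: "class_labels s' = class_labels s @ [(a, l)]"
    using assms by (intro ftrans_class_labels)
  have unique: "ftrans s x s' \<longleftrightarrow> x = (a, l)" for x
    using ftrans_class_labels[OF assms(1), of x s'] labels assms(3) by auto
  have no: "\<not> ftrans s' x s" for x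
    using ftrans_class_labels[OF assms(2), of x s] labels by auto
  have "{x. ftrans s x s'} = {(a, l)}" "{x. ftrans s' x s} = {}"
    by (simp_all add: unique no)
  moreover have "btrans bw s' (b, r) s \<longleftrightarrow> (b, r) = (a, bw l)" for b r
    by (auto simp: btrans_iff_ftrans[OF assms(1,2)] unique)
  then have "{x. btrans bw s' x s} = {(a, bw l)}" by auto
  moreover have "{x. btrans bw s x s'} = {}"
    by (auto simp: btrans_iff_ftrans[OF assms(2,1)] no)
  ultimately show "ctmc_rate bw s s' = l" "ctmc_rate bw s' s = bw l"
    unfolding ctmc_rate_def by (simp_all only: infsum_empty) simp_all
qed

lemma ctmc_rate_no_ftrans:
  assumes "par_free_class s" "par_free_class s'" "\<And>x. \<not> ftrans s x s'" "\<And>x. \<not> ftrans s' x s"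
  shows "ctmc_rate bw s s' = 0"
proof -
  have "{x. ftrans s x s'} = {}" "{x. btrans bw s x s'} = {}"
    using assms(3,4) btrans_iff_ftrans[OF assms(2,1), of bw] by auto
  then show ?thesis unfolding ctmc_rate_def by (simp only: infsum_empty add_0_left)
qed

definition class_weight :: "(real \<Rightarrow> real) \<Rightarrow> ('a, 'k) proc set \<Rightarrow> real" where
  "class_weight bw s = (\<Prod>(a, l)\<leftarrow>class_labels s. l / bw l)"

lemma class_weight_pos:
  assumes bw: "\<And>l. l > 0 \<Longrightarrow> bw l > 0" and "par_free_class s"
  shows "class_weight bw s > 0"
proof -
  obtain S where S: "S \<in> reachable_procs" "s = kclass S"
    using assms(2) by (auto simp: par_free_class_def)
  have pos: "\<forall>(a, l) \<in> set (exec_labels S). l > 0"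
    using exec_labels_pos[OF std_unexec_reachable[OF S(1)]] by auto
  have "(\<Prod>(a, l)\<leftarrow>xs. l / bw l) > 0" if "\<forall>(a, l) \<in> set xs. l > 0" for xs :: "('a \<times> real) list"
    using that by (induction xs) (auto intro!: mult_pos_pos divide_pos_pos bw)
  from this[OF pos] show ?thesis using S by (simp add: class_weight_def)
qed

lemma class_weight_balance:
  assumes bw: "\<And>l. l > 0 \<Longrightarrow> bw l > 0" and "par_free_class s" "par_free_class s'"
  shows "class_weight bw s * ctmc_rate bw s s' = class_weight bw s' * ctmc_rate bw s' s"
proof -
  \<comment> \<open>The transition appends \<open>(a, l)\<close>, so \<open>v\<close> has the weight
    of \<open>u\<close> times \<open>l / bw l\<close>; the rate \<open>bw l\<close> of the way back
    cancels the denominator.\<close>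
  have edge: "class_weight bw u * ctmc_rate bw u v = class_weight bw v * ctmc_rate bw v u"
    if uv: "par_free_class u" "par_free_class v" "ftrans u (a, l) v" for u v :: "('a, 'b) proc set" and a l
    using ctmc_rate_ftrans[OF uv, of bw] ftrans_class_labels[OF uv(1,3)]
      bw[OF ftrans_rate_pos[OF uv(1,3)]]
    by (simp add: class_weight_def)
  consider a l where "ftrans s (a, l) s'" | a l where "ftrans s' (a, l) s"
    | "\<And>x. \<not> ftrans s x s'" "\<And>x. \<not> ftrans s' x s" by auto
  then show ?thesis
  proof cases
    case 3
    then show ?thesis using ctmc_rate_no_ftrans[of s s' bw] ctmc_rate_no_ftrans[of s' s bw] assms(2,3)
      by simp
  qed (use edge assms(2,3) in metis)+
qed

section \<open>The underlying chain\<close>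

context
  fixes bw :: "real \<Rightarrow> real" and R :: "('a, 'k) proc"
  assumes bw_pos: "\<And>l. l > 0 \<Longrightarrow> bw l > 0"
    and reach: "R \<in> reachable_procs"
    and par_free: "par_free R"
begin

abbreviation "edge u v \<equiv> \<exists>x. ftrans u x v \<or> btrans bw u x v"

lemma states_rep:
  assumes "s \<in> ctmc_states bw R"
  shows "\<exists>S. S \<in> reachable_procs \<and> par_free S \<and> unexec S = unexec R \<and> s = kclass S"
proof -
  have "edge\<^sup>*\<^sup>* (kclass R) s" using assms by (simp add: ctmc_states_def)
  then show ?thesis
  proof (induction rule: rtranclp_induct)
    case base
    then show ?case using reach par_free by blast
  next
    case (step u v)
    \<comment> \<open>\<open>S\<close> comes from the induction and \<open>T\<close> from the
      transition. Both represent \<open>u\<close>, so they have the same unexecuted form.\<close>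
    then obtain S T T' where S: "unexec S = unexec R" "u = kclass S" "S \<in> reachable_procs"
      and T: "T' \<in> reachable_procs" "u = kclass T" "v = kclass T'" "unexec T = unexec T'"
      by (fastforce simp: ftrans_def btrans_def dest: fstep_unexec bstep_unexec)
    then have "unexec T' = unexec R" using kclass_invariant(1)[of S T] by simp
    then show ?case using T par_free par_free_unexec by metis
  qed
qed

lemma states_par_free: "s \<in> ctmc_states bw R \<Longrightarrow> par_free_class s"
  using states_rep by (auto simp: par_free_class_def)

lemma finite_ctmc_states: "finite (ctmc_states bw R)"
  by (rule finite_subset[OF _ finite_kclasses[of "unexec R"]]) (use states_rep in blast)

text \<open>A backward transition is a forward one read the other way, so each edge carries a
  forward transition in one direction. The two classes differ because their label sequences have
  different lengths.\<close>

lemma edge_rate: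
  assumes "s \<in> ctmc_states bw R" "s' \<in> ctmc_states bw R" "edge s s'"
  shows "s \<noteq> s' \<and> ctmc_rate bw s s' > 0 \<and> ctmc_rate bw s' s > 0"
proof -
  have fwd: "u \<noteq> v \<and> ctmc_rate bw u v > 0 \<and> ctmc_rate bw v u > 0"
    if uv: "par_free_class u" "par_free_class v" "ftrans u (a, l) v" for u v :: "('a, 'k) proc set" and a l
    using ctmc_rate_ftrans[OF uv, of bw] ftrans_class_labels[OF uv(1,3)]
      ftrans_rate_pos[OF uv(1,3)] bw_pos by auto
  have pf: "par_free_class s" "par_free_class s'"
    using assms(1,2) by (auto intro: states_par_free)
  from assms(3) obtain a l where "ftrans s (a, l) s' \<or> ftrans s' (a, l) s"
    using btrans_iff_ftrans[OF pf(2,1), of bw] by fastforce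
  then show ?thesis using fwd pf by blast
qed

lemma reversible_chain_underlying_ctmc:
  "reversible_chain (underlying_ctmc bw R) (class_weight bw)"
proof
  let ?M = "underlying_ctmc bw R"
  have M: "fst ?M = ctmc_states bw R" "snd ?M = ctmc_rate bw"
    by (simp_all add: underlying_ctmc_def)
  show "finite (fst ?M)" using finite_ctmc_states by (simp add: M)
  have init: "kclass R \<in> ctmc_states bw R" by (simp add: ctmc_states_def)
  then show "fst ?M \<noteq> {}" by (auto simp: M)
  show "class_weight bw s > 0" if "s \<in> fst ?M" for s
    using that bw_pos states_par_free class_weight_pos by (metis M(1))
  show "snd ?M s s' \<ge> 0" if "s \<in> fst ?M" "s' \<in> fst ?M" "s \<noteq> s'" for s s'
  proof (cases "edge s s'")
    case True
    then show ?thesis using edge_rate[of s s'] that by (simp add: M less_imp_le)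
  next
    case False
    then have "{x. ftrans s x s'} = {}" "{x. btrans bw s x s'} = {}" by auto
    then show ?thesis unfolding M ctmc_rate_def by (simp only: infsum_empty)
  qed
  show "class_weight bw s * snd ?M s s' = class_weight bw s' * snd ?M s' s"
    if "s \<in> fst ?M" "s' \<in> fst ?M" "s \<noteq> s'" for s s'
    using that class_weight_balance[of bw s s'] bw_pos states_par_free by (simp add: M)
  let ?E = "\<lambda>u v. u \<in> fst ?M \<and> v \<in> fst ?M \<and> u \<noteq> v \<and> snd ?M u v > 0"
  \<comment> \<open>Edges have positive rates both ways, so a path from the initial class can be
    retraced; any two states are then connected through that class.\<close>
  have from_init: "?E\<^sup>*\<^sup>* (kclass R) s \<and> ?E\<^sup>*\<^sup>* s (kclass R)" if "s \<in> fst ?M" for s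
  proof -
    have "edge\<^sup>*\<^sup>* (kclass R) s" using that by (simp add: M ctmc_states_def)
    then show ?thesis
    proof (induction rule: rtranclp_induct)
      case (step u v)
      have u: "u \<in> ctmc_states bw R" using step.hyps by (simp add: ctmc_states_def)
      have v: "v \<in> ctmc_states bw R"
        using step.hyps by (auto simp: ctmc_states_def intro: rtranclp.rtrancl_into_rtrancl)
      have uv: "?E u v" "?E v u" using edge_rate[OF u v step.hyps(2)] u v by (auto simp: M)
      show ?case
        using rtranclp.rtrancl_into_rtrancl[of ?E, OF _ uv(1)]
          converse_rtranclp_into_rtranclp[of ?E, OF uv(2)] step.IH by (intro conjI) blast+
    qed simp
  qed
  show "?E\<^sup>*\<^sup>* s s'" if "s \<in> fst ?M" "s' \<in> fst ?M" for s s'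
    using rtranclp_trans[of ?E s "kclass R" s'] from_init[OF that(1)] from_init[OF that(2)] by simp
qed

end

theorem theorem4p16:
  fixes bw :: "real \<Rightarrow> real" and R :: "('a::countable, 'k::countable) proc"
  assumes "\<And>l. l > 0 \<Longrightarrow> bw l > 0"
    and "R \<in> reachable_procs"
    and "par_free R"
  shows "time_reversible (underlying_ctmc bw R)"
  using reversible_chain.time_reversible[OF reversible_chain_underlying_ctmc[OF assms]] .

end
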